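(* Let $\mathcal{H}$ be a $k$-uniform hypergraph with $n$ vertices, and let $\mathcal{S}(\mathcal{H})$ be its Seidel matrix. Then $$\|\mathcal{S}(\mathcal{H})\|_F\ge\sqrt{n(n-1)},$$ and equality holds if and only if $\mathcal{H}$ is linear.
   Context: A hypergraph $\mathcal{H}=(V,E)$ consists of a finite vertex set $V$ with $|V|=n$ (identified with $\{1,\dots,n\}$) and a set $E\subseteq 2^{V}$ of hyperedges. All hypergraphs are finite and simple: there is no hyperedge of size $1$, and for distinct hyperedges $e,e'$ neither $e\subset e'$ nor $e'\subset e$. $\mathcal{H}$ is $k$-uniform if every hyperedge has exactly $k$ elements. For distinct vertices $i,j$, the co-degree is $c_{ij}=|\{e\in E: i,j\in e\}|$. The Seidel matrix $\mathcal{S}(\mathcal{H})$ is the real symmetric $n\times n$ matrix with $\mathcal{S}(\mathcal{H})_{ii}=0$ and $\mathcal{S}(\mathcal{H})_{ij}=1-2c_{ij}$ for $i\ne j$. The Frobenius norm of a matrix $M=(m_{ij})$ is $\|M\|_F=\left(\sum_{i,j}|m_{ij}|^2\right)^{1/2}$. A hypergraph is linear if it is simple and $|e\cap e'|\le 1$ for all distinct hyperedges $e,e'$. *)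

theory Defs
  imports Complex_Main "Jordan_Normal_Form.Matrix"
begin

text \<open>A hypergraph on the vertex set \<open>V\<close> is given by its set of hyperedges \<open>E\<close>. All
  hypergraphs are finite and simple, so simplicity is part of the definition.\<close>

definition hypergraph :: "'a set \<Rightarrow> 'a set set \<Rightarrow> bool" where
  "hypergraph V E \<longleftrightarrow> finite V \<and> E \<subseteq> Pow V \<and> (\<forall>e\<in>E. card e \<noteq> 1) \<and>
     (\<forall>e\<in>E. \<forall>e'\<in>E. e \<noteq> e' \<longrightarrow> \<not> e \<subset> e' \<and> \<not> e' \<subset> e)"

definition uniform_hypergraph :: "nat \<Rightarrow> 'a set \<Rightarrow> 'a set set \<Rightarrow> bool" where
  "uniform_hypergraph k V E \<longleftrightarrow> hypergraph V E \<and> (\<forall>e\<in>E. card e = k)"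

definition linear_hypergraph :: "'a set \<Rightarrow> 'a set set \<Rightarrow> bool" where
  "linear_hypergraph V E \<longleftrightarrow> hypergraph V E \<and>
     (\<forall>e\<in>E. \<forall>e'\<in>E. e \<noteq> e' \<longrightarrow> card (e \<inter> e') \<le> 1)"

definition codegree :: "'a set set \<Rightarrow> 'a \<Rightarrow> 'a \<Rightarrow> nat" where
  "codegree E i j = card {e \<in> E. i \<in> e \<and> j \<in> e}"

text \<open>The vertex set is \<open>{1..n}\<close>, while the rows and columns of a matrix are numbered from \<open>0\<close>:
  vertex \<open>Suc i\<close> belongs to row and column \<open>i\<close>.\<close>

definition seidel_mat :: "nat \<Rightarrow> nat set set \<Rightarrow> real mat" where
  "seidel_mat n E =
     mat n n (\<lambda>(i, j). if i = j then 0 else 1 - 2 * real (codegree E (Suc i) (Suc j)))"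

definition frobenius_norm :: "real mat \<Rightarrow> real" where
  "frobenius_norm M = sqrt (\<Sum>i<dim_row M. \<Sum>j<dim_col M. \<bar>M $$ (i, j)\<bar>\<^sup>2)"

end

theory Submission
  imports Defs
begin

text \<open>An off-diagonal entry \<open>1 - 2c\<close> of the Seidel matrix has square \<open>1 + 4c(c - 1)\<close>, where the
  excess \<open>4c(c - 1)\<close> is nonnegative for a natural number \<open>c\<close> and vanishes exactly for \<open>c \<le> 1\<close>. So
  equality of the norms says that all codegrees are at most \<open>1\<close>: no two vertices lie in two
  common hyperedges.\<close>

lemma codegree_le_1_iff:
  assumes "finite E"
  shows "codegree E i j \<le> 1 \<longleftrightarrow>
    (\<forall>e\<in>E. \<forall>e'\<in>E. i \<in> e \<inter> e' \<and> j \<in> e \<inter> e' \<longrightarrow> e = e')"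
  using assms by (auto simp: codegree_def card_le_Suc0_iff_eq)

text \<open>Both sides forbid two distinct vertices in two distinct common hyperedges; only the
  order of quantification differs. Vertices may range over \<open>V\<close> because every hyperedge
  is a subset of \<open>V\<close>.\<close>

lemma linear_hypergraph_iff_codegree:
  assumes "hypergraph V E"
  shows "linear_hypergraph V E \<longleftrightarrow> (\<forall>i\<in>V. \<forall>j\<in>V. i \<noteq> j \<longrightarrow> codegree E i j \<le> 1)"
proof -
  have E: "finite E" and sub: "\<And>e. e \<in> E \<Longrightarrow> e \<subseteq> V" and fin: "\<And>e. e \<in> E \<Longrightarrow> finite e"
    using assms by (auto simp: hypergraph_def intro: finite_subset)
  have "linear_hypergraph V E \<longleftrightarrow>
      (\<forall>e\<in>E. \<forall>e'\<in>E. e \<noteq> e' \<longrightarrow> (\<forall>i\<in>e \<inter> e'. \<forall>j\<in>e \<inter> e'. i = j))"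
    using assms fin by (simp add: linear_hypergraph_def card_le_Suc0_iff_eq)
  also have "\<dots> \<longleftrightarrow> (\<forall>i\<in>V. \<forall>j\<in>V. i \<noteq> j \<longrightarrow> codegree E i j \<le> 1)"
    unfolding codegree_le_1_iff[OF E] using sub by blast
  finally show ?thesis .
qed

lemma sum_off_diagonal:
  "(\<Sum>i<n. \<Sum>j<n. if i = j then 0 else 1) = real n * (real n - 1)"
proof -
  have "(\<Sum>j<n. if i = j then 0 else 1) = real n - 1" if "i < n" for i
  proof -
    have "(\<Sum>j<n. if i = j then 0 else 1) = (\<Sum>j<n. 1 - (if i = j then 1 else 0 :: real))"
      by (intro sum.cong) auto
    then show ?thesis
      using that by (simp add: sum_subtractf)
  qed
  then show ?thesis by simp
qed

text \<open>The value 0 on the diagonal matches the zero diagonal of the Seidel matrix, where the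
  baseline is 0 instead of 1.\<close>

definition seidel_excess :: "nat set set \<Rightarrow> nat \<Rightarrow> nat \<Rightarrow> real" where
  "seidel_excess E i j = (if i = j then 0
     else 4 * real (codegree E (Suc i) (Suc j)) * (real (codegree E (Suc i) (Suc j)) - 1))"

text \<open>The factor \<open>c - 1\<close> is negative only for \<open>c = 0\<close>, and then the
  factor \<open>c\<close> vanishes; hence the case split on the codegree.\<close>

lemma seidel_excess_nonneg: "seidel_excess E i j \<ge> 0"
  by (cases "codegree E (Suc i) (Suc j)") (auto simp: seidel_excess_def)

lemma seidel_excess_eq_0_iff:
  "seidel_excess E i j = 0 \<longleftrightarrow> (i \<noteq> j \<longrightarrow> codegree E (Suc i) (Suc j) \<le> 1)"
  by (auto simp: seidel_excess_def le_Suc_eq)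

lemma frobenius_norm_seidel_mat:
  "frobenius_norm (seidel_mat n E) =
    sqrt (real n * (real n - 1) + (\<Sum>i<n. \<Sum>j<n. seidel_excess E i j))"
proof -
  have "(\<Sum>i<n. \<Sum>j<n. \<bar>seidel_mat n E $$ (i, j)\<bar>\<^sup>2) =
      (\<Sum>i<n. \<Sum>j<n. (if i = j then 0 else 1) + seidel_excess E i j)"
    by (intro sum.cong)
      (auto simp: seidel_mat_def seidel_excess_def power2_eq_square algebra_simps)
  then show ?thesis
    by (simp add: frobenius_norm_def seidel_mat_def sum.distrib sum_off_diagonal)
qed

theorem theorem3p3:
  fixes n k :: nat and E :: "nat set set"
  assumes "uniform_hypergraph k {1..n} E"
  shows "frobenius_norm (seidel_mat n E) \<ge> sqrt (real n * (real n - 1)) \<and>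
    (frobenius_norm (seidel_mat n E) = sqrt (real n * (real n - 1)) \<longleftrightarrow>
      linear_hypergraph {1..n} E)"
proof -
  have "hypergraph {1..n} E"
    using assms by (simp add: uniform_hypergraph_def)
  \<comment> \<open>Writing \<open>{1..n}\<close> as the image of \<open>{..<n}\<close> under
    \<open>Suc\<close> turns vertices into matrix indices.\<close>
  then have "linear_hypergraph {1..n} E \<longleftrightarrow>
      (\<forall>i\<in>Suc ` {..<n}. \<forall>j\<in>Suc ` {..<n}. i \<noteq> j \<longrightarrow> codegree E i j \<le> 1)"
    by (simp only: linear_hypergraph_iff_codegree image_Suc_lessThan)
  also have "\<dots> \<longleftrightarrow> (\<forall>i<n. \<forall>j<n. seidel_excess E i j = 0)"
    by (auto simp: seidel_excess_eq_0_iff)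
  \<comment> \<open>No cancellation can occur, since all terms are nonnegative.\<close>
  also have "\<dots> \<longleftrightarrow> (\<Sum>i<n. \<Sum>j<n. seidel_excess E i j) = 0"
    by (auto simp: sum_nonneg_eq_0_iff sum_nonneg seidel_excess_nonneg)
  \<comment> \<open>As \<open>sqrt\<close> is strictly increasing, both claims reduce to the total
    excess being nonnegative, and zero exactly in the linear case.\<close>
  finally show ?thesis
    by (simp add: frobenius_norm_seidel_mat sum_nonneg seidel_excess_nonneg)
qed

end
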